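(* For every $\theta=(I,E,h)$ with $I=(I_1,\dots,I_{|I|})$ a partition of $\{1,\dots,d\}$, $E\in\mathcal E_\eta$ and $h=(h_1,\dots,h_d)$ with positive entries, the kernel $K_\theta$ satisfies $$\int K_\theta(t)dt=1,\qquad\|K_\theta\|_1\le(2|I|-1)\|g\|_1^d,\qquad\|K_\theta\|_2\le|\det E|^{1/2}\|g\|_2^d\Big(\sum_{i=1}^{|I|}\prod_{j\in I_i}h_j^{-1/2}+|I|-1\Big).$$
   Context: $g:[-1/2,1/2]\to\mathbb R$ is a univariate kernel with $\int g=1$, $\int g(x)x^kdx=0$ for $k=1,\dots,\ell$, and $g\in C^1$ (Assumption G). For fixed $\eta>0$, $\mathcal E_\eta=\{E=(e_1,\dots,e_d):e_i\in\mathbb S^{d-1},|\det E|\ge\eta\}$. $G_0(t)=\prod_{i=1}^dg(t_i)$, $G_{i,h}(t)=\prod_{j\in I_i}h_j^{-1}g(t_j/h_j)\prod_{j\notin I_i}g(t_j)$, and $K_\theta(t)=|\det E|\sum_{i=1}^{|I|}G_{i,h}(E^Tt)-(|I|-1)|\det E|\,G_0(E^Tt)$, $t\in\mathbb R^d$. Norms $\|\cdot\|_1,\|\cdot\|_2$ are $\mathbb L_1,\mathbb L_2$ norms over $\mathbb R^d$ (resp. $\mathbb R$ for $g$). *)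

theory Defs
  imports "HOL-Analysis.Analysis" "HOL-Library.Disjoint_Sets"
begin

text \<open>Assumption G on the univariate kernel g, supported on [-1/2,1/2] (extended by zero).\<close>
definition assumption_G :: "nat \<Rightarrow> (real \<Rightarrow> real) \<Rightarrow> bool" where
  "assumption_G l g \<longleftrightarrow>
     (\<forall>x. x \<notin> {-1/2..1/2} \<longrightarrow> g x = 0) \<and>
     (g has_integral 1) {-1/2..1/2} \<and>
     (\<forall>k\<in>{1..l}. ((\<lambda>x. g x * x ^ k) has_integral 0) {-1/2..1/2}) \<and>
     g C1_differentiable_on {-1/2..1/2}"

text \<open>The class E_eta: matrices whose columns e_i are unit vectors, with |det E| >= eta.\<close>
definition E_eta :: "real \<Rightarrow> (real^'n^'n) set" where
  "E_eta \<eta> = {E. (\<forall>i. norm (column i E) = 1) \<and> \<bar>det E\<bar> \<ge> \<eta>}"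

definition G0 :: "(real \<Rightarrow> real) \<Rightarrow> real^'n \<Rightarrow> real" where
  "G0 g t = (\<Prod>j\<in>UNIV. g (t $ j))"

definition Gh :: "(real \<Rightarrow> real) \<Rightarrow> 'n set \<Rightarrow> real^'n \<Rightarrow> real^'n \<Rightarrow> real" where
  "Gh g A h t = (\<Prod>j\<in>A. g (t $ j / h $ j) / h $ j) * (\<Prod>j\<in>UNIV - A. g (t $ j))"

text \<open>K_theta for theta = (P, E, h); P is the partition (blocks I_1..I_|I|), E^T t = transpose E *v t.\<close>
definition Ktheta :: "(real \<Rightarrow> real) \<Rightarrow> 'n set set \<Rightarrow> real^'n^'n \<Rightarrow> real^'n \<Rightarrow> real^'n \<Rightarrow> real" where
  "Ktheta g P E h t =
     \<bar>det E\<bar> * (\<Sum>A\<in>P. Gh g A h (transpose E *v t))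
     - (real (card P) - 1) * \<bar>det E\<bar> * G0 g (transpose E *v t)"

end

theory Submission
  imports Defs
begin

text \<open>\<open>K\<^sub>\<theta>\<close> is \<open>\<bar>det E\<bar>\<close> times a signed combination of \<open>|I| + 1\<close> product kernels
  \<open>Gh g A h\<close> (with \<open>G0 g = Gh g {} h\<close>) evaluated at \<open>E\<^sup>T t\<close>. By Fubini and one-dimensional
  rescaling, each product kernel has integral 1, \<open>L\<^sub>1\<close> norm \<open>\<parallel>g\<parallel>\<^sub>1 ^ d\<close> and \<open>L\<^sub>2\<close> norm
  \<open>\<parallel>g\<parallel>\<^sub>2 ^ d\<close> times the product of \<open>h\<^sub>j powr (-1/2)\<close> over its block, and the substitution
  \<open>t \<mapsto> E\<^sup>T t\<close> divides integrals by \<open>\<bar>det E\<bar>\<close>. Hence \<open>\<integral>K\<^sub>\<theta> = |I| - (|I| - 1) = 1\<close>, the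
  \<open>L\<^sub>1\<close> bound is the triangle inequality and the \<open>L\<^sub>2\<close> bound is Minkowski's inequality.\<close>

section \<open>The \<open>L\<^sub>2\<close> norm\<close>

definition L2_norm :: "'a measure \<Rightarrow> ('a \<Rightarrow> real) \<Rightarrow> real" where
  "L2_norm M f = sqrt (\<integral>x. (f x)\<^sup>2 \<partial>M)"

lemma L2_norm_cmult: "L2_norm M (\<lambda>x. c * f x) = \<bar>c\<bar> * L2_norm M f"
  by (simp add: L2_norm_def power_mult_distrib real_sqrt_mult)

lemma integrable_mult_of_square_integrable:
  fixes X Y :: "'a \<Rightarrow> real"
  assumes [measurable]: "X \<in> borel_measurable M" "Y \<in> borel_measurable M"
    and "integrable M (\<lambda>x. (X x)\<^sup>2)" "integrable M (\<lambda>x. (Y x)\<^sup>2)"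
  shows "integrable M (\<lambda>x. X x * Y x)"
proof (rule Bochner_Integration.integrable_bound)
  show "integrable M (\<lambda>x. (X x)\<^sup>2 + (Y x)\<^sup>2)" using assms(3,4) by simp
  show "AE x in M. norm (X x * Y x) \<le> norm ((X x)\<^sup>2 + (Y x)\<^sup>2)"
  proof (rule AE_I2)
    fix x
    show "norm (X x * Y x) \<le> norm ((X x)\<^sup>2 + (Y x)\<^sup>2)"
    proof -
      have "2 * (\<bar>X x\<bar> * \<bar>Y x\<bar>) \<le> (X x)\<^sup>2 + (Y x)\<^sup>2"
        using sum_squares_bound[of "\<bar>X x\<bar>" "\<bar>Y x\<bar>"] by (simp add: mult.assoc)
      moreover have "0 \<le> \<bar>X x\<bar> * \<bar>Y x\<bar>" by simp
      ultimately have "\<bar>X x\<bar> * \<bar>Y x\<bar> \<le> (X x)\<^sup>2 + (Y x)\<^sup>2" by linarith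
      then show ?thesis by (simp add: abs_mult)
    qed
  qed
qed simp

lemma Cauchy_Schwarz_integral:
  fixes X Y :: "'a \<Rightarrow> real"
  assumes [measurable]: "X \<in> borel_measurable M" "Y \<in> borel_measurable M"
    and X2: "integrable M (\<lambda>x. (X x)\<^sup>2)" and Y2: "integrable M (\<lambda>x. (Y x)\<^sup>2)"
  shows "(\<integral>x. X x * Y x \<partial>M) \<le> L2_norm M X * L2_norm M Y"
proof -
  have XY: "integrable M (\<lambda>x. \<bar>X x\<bar> * \<bar>Y x\<bar>)"
    using integrable_mult_of_square_integrable[OF assms] by (simp flip: abs_mult)
  have "ennreal ((\<integral>x. \<bar>X x\<bar> * \<bar>Y x\<bar> \<partial>M)\<^sup>2) = (\<integral>\<^sup>+x. ennreal \<bar>X x\<bar> * ennreal \<bar>Y x\<bar> \<partial>M)\<^sup>2"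
    using XY by (simp add: nn_integral_eq_integral flip: ennreal_power ennreal_mult)
  also have "\<dots> \<le> (\<integral>\<^sup>+x. ennreal \<bar>X x\<bar> ^ 2 \<partial>M) * (\<integral>\<^sup>+x. ennreal \<bar>Y x\<bar> ^ 2 \<partial>M)"
    by (rule Cauchy_Schwarz_nn_integral) auto
  also have "\<dots> = ennreal ((\<integral>x. (X x)\<^sup>2 \<partial>M) * (\<integral>x. (Y x)\<^sup>2 \<partial>M))"
  proof -
    have "ennreal \<bar>f x\<bar> ^ 2 = ennreal ((f x)\<^sup>2)" for f :: "'a \<Rightarrow> real" and x
      by (simp add: ennreal_power)
    then show ?thesis
      using X2 Y2 by (simp add: nn_integral_eq_integral ennreal_mult)
  qed
  finally have "(\<integral>x. \<bar>X x\<bar> * \<bar>Y x\<bar> \<partial>M)\<^sup>2 \<le> (\<integral>x. (X x)\<^sup>2 \<partial>M) * (\<integral>x. (Y x)\<^sup>2 \<partial>M)"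
    by (subst (asm) ennreal_le_iff) (auto intro!: mult_nonneg_nonneg integral_nonneg)
  then have "(\<integral>x. \<bar>X x\<bar> * \<bar>Y x\<bar> \<partial>M) \<le> L2_norm M X * L2_norm M Y"
    by (simp add: L2_norm_def real_le_rsqrt flip: real_sqrt_mult)
  moreover have "(\<integral>x. X x * Y x \<partial>M) \<le> (\<integral>x. \<bar>X x\<bar> * \<bar>Y x\<bar> \<partial>M)"
    using XY integrable_mult_of_square_integrable[OF assms]
    by (intro integral_mono) (auto simp flip: abs_mult)
  ultimately show ?thesis by linarith
qed

lemma L2_norm_add_le:
  fixes X Y :: "'a \<Rightarrow> real"
  assumes [measurable]: "X \<in> borel_measurable M" "Y \<in> borel_measurable M"
    and X2: "integrable M (\<lambda>x. (X x)\<^sup>2)" and Y2: "integrable M (\<lambda>x. (Y x)\<^sup>2)"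
  shows "integrable M (\<lambda>x. (X x + Y x)\<^sup>2)"
    and "L2_norm M (\<lambda>x. X x + Y x) \<le> L2_norm M X + L2_norm M Y"
proof -
  have XY: "integrable M (\<lambda>x. X x * Y x)"
    by (rule integrable_mult_of_square_integrable[OF assms])
  have sq: "(X x + Y x)\<^sup>2 = (X x)\<^sup>2 + 2 * (X x * Y x) + (Y x)\<^sup>2" for x
    by (simp add: power2_sum)
  show "integrable M (\<lambda>x. (X x + Y x)\<^sup>2)"
    unfolding sq using X2 Y2 XY by simp
  have "(\<integral>x. (X x + Y x)\<^sup>2 \<partial>M) = (L2_norm M X)\<^sup>2 + 2 * (\<integral>x. X x * Y x \<partial>M) + (L2_norm M Y)\<^sup>2"
    unfolding sq L2_norm_def using X2 Y2 XY by simp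
  also have "\<dots> \<le> (L2_norm M X + L2_norm M Y)\<^sup>2"
    using Cauchy_Schwarz_integral[OF assms] by (simp add: power2_sum)
  finally show "L2_norm M (\<lambda>x. X x + Y x) \<le> L2_norm M X + L2_norm M Y"
    by (simp add: L2_norm_def real_le_lsqrt)
qed

lemma L2_norm_sum_le:
  fixes F :: "'i \<Rightarrow> 'a \<Rightarrow> real"
  assumes "finite S" and "\<And>i. i \<in> S \<Longrightarrow> F i \<in> borel_measurable M"
    and "\<And>i. i \<in> S \<Longrightarrow> integrable M (\<lambda>x. (F i x)\<^sup>2)"
  shows "integrable M (\<lambda>x. (\<Sum>i\<in>S. F i x)\<^sup>2)
    \<and> L2_norm M (\<lambda>x. \<Sum>i\<in>S. F i x) \<le> (\<Sum>i\<in>S. L2_norm M (F i))"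
  using assms
proof (induction S rule: finite_induct)
  case (insert a S)
  have "(\<lambda>x. \<Sum>i\<in>S. F i x) \<in> borel_measurable M" using insert.prems by auto
  from L2_norm_add_le[OF insert.prems(1)[of a] this insert.prems(2)[of a]] insert
  show ?case by simp
qed (simp add: L2_norm_def)

section \<open>Integrals of products and rescalings\<close>

lemma lborel_integral_prod_Basis:
  fixes f :: "'a::euclidean_space \<Rightarrow> real \<Rightarrow> real"
  assumes f: "\<And>b. b \<in> Basis \<Longrightarrow> integrable lborel (f b)"
  shows "integrable lborel (\<lambda>x::'a. \<Prod>b\<in>Basis. f b (x \<bullet> b))"
    and "(\<integral>x. (\<Prod>b\<in>Basis. f b (x \<bullet> b)) \<partial>lborel) = (\<Prod>b\<in>Basis. \<integral>y. f b y \<partial>lborel)"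
proof -
  interpret product_sigma_finite "\<lambda>_::'a. lborel :: real measure" ..
  let ?T = "\<lambda>x. \<Sum>b\<in>Basis. x b *\<^sub>R (b::'a)"
  have [measurable]: "f b \<in> borel_measurable borel" if "b \<in> Basis" for b
    using f[OF that] by auto
  have T [measurable]: "?T \<in> measurable (\<Pi>\<^sub>M b\<in>Basis. lborel) borel" by measurable
  have F [measurable]: "(\<lambda>x::'a. \<Prod>b\<in>Basis. f b (x \<bullet> b)) \<in> borel_measurable borel" by measurable
  have "(\<Prod>b\<in>Basis. f b (?T x \<bullet> b)) = (\<Prod>b\<in>Basis. f b (x b))" for x
    by (intro prod.cong) (simp_all add: inner_sum_left inner_Basis if_distrib cong: if_cong)
  then have "integrable (distr (\<Pi>\<^sub>M b\<in>Basis. lborel) borel ?T) (\<lambda>x::'a. \<Prod>b\<in>Basis. f b (x \<bullet> b))"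
    and "(\<integral>x. (\<Prod>b\<in>Basis. f b (x \<bullet> b)) \<partial>distr (\<Pi>\<^sub>M b\<in>Basis. lborel) borel ?T)
      = (\<Prod>b\<in>Basis. \<integral>y. f b y \<partial>lborel)"
    using product_integrable_prod[OF _ f] product_integral_prod[OF _ f]
    by (simp_all add: integrable_distr_eq[OF T F] integral_distr[OF T F])
  then show "integrable lborel (\<lambda>x::'a. \<Prod>b\<in>Basis. f b (x \<bullet> b))"
    and "(\<integral>x. (\<Prod>b\<in>Basis. f b (x \<bullet> b)) \<partial>lborel) = (\<Prod>b\<in>Basis. \<integral>y. f b y \<partial>lborel)"
    by (simp_all flip: lborel_eq)
qed

lemma prod_Basis_vec: "(\<Prod>b\<in>Basis. u b) = (\<Prod>j\<in>UNIV. u (axis j (1::real)))"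
  by (simp add: Basis_vec_def axis_eq_axis prod.UNION_disjoint)

lemma lborel_integral_prod_cart:
  fixes f :: "'n::finite \<Rightarrow> real \<Rightarrow> real"
  assumes f: "\<And>j. integrable lborel (f j)"
  shows "integrable lborel (\<lambda>t::real^'n. \<Prod>j\<in>UNIV. f j (t $ j))"
    and "(\<integral>t. (\<Prod>j\<in>UNIV. f j (t $ j)) \<partial>lborel) = (\<Prod>j\<in>UNIV. \<integral>y. f j y \<partial>lborel)"
proof -
  define f' where "f' b = f (SOME j. b = axis j (1::real))" for b :: "real^'n"
  have f'_axis [simp]: "f' (axis j 1) = f j" for j
    by (simp add: f'_def axis_eq_axis)
  have "integrable lborel (f' b)" if "b \<in> Basis" for b
    using that f by (auto simp: Basis_vec_def)
  from lborel_integral_prod_Basis[of f', OF this]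
  show "integrable lborel (\<lambda>t::real^'n. \<Prod>j\<in>UNIV. f j (t $ j))"
    and "(\<integral>t. (\<Prod>j\<in>UNIV. f j (t $ j)) \<partial>lborel) = (\<Prod>j\<in>UNIV. \<integral>y. f j y \<partial>lborel)"
    by (simp_all add: prod_Basis_vec cart_eq_inner_axis)
qed

lemma integrable_lborel_comp_of_support:
  fixes g \<phi> :: "real \<Rightarrow> real"
  assumes supp: "\<And>x. x \<notin> {a..b} \<Longrightarrow> g x = 0" and g: "continuous_on {a..b} g"
    and \<phi>: "continuous_on UNIV \<phi>" "\<phi> 0 = 0"
  shows "integrable lborel (\<lambda>x. \<phi> (g x))"
proof -
  have "compact ((\<lambda>x. \<phi> (g x)) ` {a..b})"
    by (intro compact_continuous_image continuous_on_compose2[OF \<phi>(1) g]) auto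
  then obtain B where B: "\<And>x. x \<in> {a..b} \<Longrightarrow> \<bar>\<phi> (g x)\<bar> \<le> B"
    by (auto dest!: compact_imp_bounded simp: bounded_real) (meson atLeastAtMost_iff)
  have "g = (\<lambda>x. indicator {a..b} x *\<^sub>R g x)"
    using supp by (auto simp: indicator_def fun_eq_iff)
  then have "g \<in> borel_measurable borel"
    by (metis borel_measurable_continuous_on_indicator[OF _ g] atLeastAtMost_borel)
  then have [measurable]: "(\<lambda>x. \<phi> (g x)) \<in> borel_measurable borel"
    using \<phi>(1) by (rule borel_measurable_continuous_on[rotated])
  show ?thesis
  proof (rule Bochner_Integration.integrable_bound)
    show "integrable lborel (\<lambda>x. B * indicator {a..b} x)"
      by (simp add: integrable_indicator_iff emeasure_lborel_Icc_eq)
    show "AE x in lborel. norm (\<phi> (g x)) \<le> norm (B * indicator {a..b} x)"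
      using B supp \<phi>(2) by (intro AE_I2) (force simp: indicator_def)
  qed simp
qed

lemma lborel_integral_rescale:
  fixes u :: "real \<Rightarrow> real"
  assumes u: "integrable lborel u" and c: "c > 0"
  shows "integrable lborel (\<lambda>x. u (x / c))" and "(\<integral>x. u (x / c) \<partial>lborel) = c * (\<integral>x. u x \<partial>lborel)"
proof -
  show "integrable lborel (\<lambda>x. u (x / c))"
    using lborel_integrable_real_affine[OF u, of "1/c" 0] c by simp
  have "(\<integral>x. u x \<partial>lborel) = \<bar>1/c\<bar> *\<^sub>R (\<integral>x. u (0 + (1/c) * x) \<partial>lborel)"
    using c by (intro lborel_integral_real_affine) auto
  then show "(\<integral>x. u (x / c) \<partial>lborel) = c * (\<integral>x. u x \<partial>lborel)"
    using c by simp
qed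

lemma lborel_integral_prod_rescaled:
  fixes u :: "real \<Rightarrow> real" and h :: "real^'n::finite" and w :: "'n \<Rightarrow> real"
  assumes u: "integrable lborel u" and h: "\<forall>j. h $ j > 0"
  shows "integrable lborel (\<lambda>t::real^'n. \<Prod>j\<in>UNIV. if j \<in> A then w j * u (t $ j / h $ j) else u (t $ j))"
    and "(\<integral>t. (\<Prod>j\<in>UNIV. if j \<in> A then w j * u (t $ j / h $ j) else u (t $ j)) \<partial>lborel)
      = (\<Prod>j\<in>A. w j * h $ j) * (\<integral>x. u x \<partial>lborel) ^ CARD('n)"
proof -
  define f where "f j = (if j \<in> A then (\<lambda>x. w j * u (x / h $ j)) else u)" for j
  have f_apply: "f j x = (if j \<in> A then w j * u (x / h $ j) else u x)" for j x
    by (simp add: f_def)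
  have f: "integrable lborel (f j)"
    "(\<integral>x. f j x \<partial>lborel) = (if j \<in> A then w j * h $ j else 1) * (\<integral>x. u x \<partial>lborel)" for j
    using lborel_integral_rescale[OF u, of "h $ j"] u h by (simp_all add: f_def)
  have "(\<Prod>j\<in>UNIV. (if j \<in> A then w j * h $ j else 1) * (\<integral>x. u x \<partial>lborel))
      = (\<Prod>j\<in>A. w j * h $ j) * (\<integral>x. u x \<partial>lborel) ^ CARD('n)"
    by (simp add: prod.distrib prod.If_cases)
  moreover have "integrable lborel (\<lambda>t::real^'n. \<Prod>j\<in>UNIV. f j (t $ j))"
    "(\<integral>t. (\<Prod>j\<in>UNIV. f j (t $ j)) \<partial>lborel)
      = (\<Prod>j\<in>UNIV. (if j \<in> A then w j * h $ j else 1) * (\<integral>x. u x \<partial>lborel))"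
    using lborel_integral_prod_cart[of f, OF f(1)] by (simp_all only: f(2))
  ultimately show "integrable lborel (\<lambda>t::real^'n. \<Prod>j\<in>UNIV. if j \<in> A then w j * u (t $ j / h $ j) else u (t $ j))"
    and "(\<integral>t. (\<Prod>j\<in>UNIV. if j \<in> A then w j * u (t $ j / h $ j) else u (t $ j)) \<partial>lborel)
      = (\<Prod>j\<in>A. w j * h $ j) * (\<integral>x. u x \<partial>lborel) ^ CARD('n)"
    by (simp_all add: f_apply)
qed

section \<open>Linear changes of variables\<close>

text \<open>The change-of-variables theorems of the library require a well-ordered index type;
  \<open>'a ranked\<close> is a well-ordered copy of a finite type through which they are transported.\<close>

typedef 'a ranked = "UNIV :: 'a set" morphisms of_ranked to_ranked by simp

lemma bij_to_ranked: "bij to_ranked" and bij_of_ranked: "bij of_ranked"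
  by (metis bijI' to_ranked_inverse of_ranked_inverse UNIV_I of_ranked_inject)+

instance ranked :: (finite) finite
  by standard (metis bij_to_ranked bij_is_surj finite_imageI finite)

instantiation ranked :: (finite) linorder
begin
definition less_eq_ranked :: "'a ranked \<Rightarrow> 'a ranked \<Rightarrow> bool" where
  "x \<le> y \<longleftrightarrow> to_nat (of_ranked x) \<le> to_nat (of_ranked y)"
definition less_ranked :: "'a ranked \<Rightarrow> 'a ranked \<Rightarrow> bool" where
  "x < y \<longleftrightarrow> to_nat (of_ranked x) < to_nat (of_ranked y)"
instance
  by standard (auto simp: less_eq_ranked_def less_ranked_def of_ranked_inject)
end

instance ranked :: (finite) wellorder
proof
  fix P :: "'a ranked \<Rightarrow> bool" and x
  assume step: "\<And>x. (\<And>y. y < x \<Longrightarrow> P y) \<Longrightarrow> P x"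
  have "\<forall>x. to_nat (of_ranked x) = n \<longrightarrow> P x" for n
    by (induction n rule: less_induct) (use step in \<open>auto simp: less_ranked_def\<close>)
  then show "P x" by blast
qed

definition ranked_vec :: "real^'n \<Rightarrow> real^'n ranked" where
  "ranked_vec x = (\<chi> i. x $ of_ranked i)"

definition unranked_vec :: "real^'n ranked \<Rightarrow> real^'n" where
  "unranked_vec y = (\<chi> j. y $ to_ranked j)"

definition ranked_mat :: "real^'n^'n \<Rightarrow> real^'n ranked^'n ranked" where
  "ranked_mat M = (\<chi> i k. M $ of_ranked i $ of_ranked k)"

lemma unranked_ranked_vec [simp]: "unranked_vec (ranked_vec x) = x"
  by (simp add: ranked_vec_def unranked_vec_def to_ranked_inverse vec_eq_iff)

lemma ranked_unranked_vec [simp]: "ranked_vec (unranked_vec y) = y"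
  by (simp add: ranked_vec_def unranked_vec_def of_ranked_inverse vec_eq_iff)

lemma linear_ranked_vec: "linear ranked_vec" and linear_unranked_vec: "linear unranked_vec"
  by (auto simp: linear_iff ranked_vec_def unranked_vec_def vec_eq_iff)

lemma ranked_vec_borel [measurable]: "ranked_vec \<in> borel_measurable borel"
  and unranked_vec_borel [measurable]: "unranked_vec \<in> borel_measurable borel"
  by (intro borel_measurable_continuous_onI linear_continuous_on linear_ranked_vec linear_unranked_vec
        linear_conv_bounded_linear[THEN iffD1])+

lemma ranked_mat_mult_ranked_vec: "ranked_mat M *v ranked_vec t = ranked_vec (M *v t)"
  unfolding ranked_mat_def ranked_vec_def matrix_vector_mult_def
  by (simp add: vec_eq_iff sum.reindex_bij_betw[OF bij_of_ranked, of "\<lambda>k. M $ of_ranked _ $ k * t $ k"])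

lemma distr_ranked_vec_lborel: "distr lborel borel (ranked_vec :: real^'n::finite \<Rightarrow> _) = lborel"
proof (rule lborel_eqI[symmetric])
  fix l u :: "real^'n ranked"
  assume lu: "\<And>b. b \<in> Basis \<Longrightarrow> l \<bullet> b \<le> u \<bullet> b"
  have le: "l $ i \<le> u $ i" for i
    using lu[of "axis i 1"] by (auto simp: cart_eq_inner_axis Basis_vec_def)
  have "ranked_vec -` box l u = box (unranked_vec l) (unranked_vec u)"
    by (auto simp: mem_box_cart ranked_vec_def unranked_vec_def to_ranked_inverse)
      (metis of_ranked_inverse to_ranked_inverse UNIV_I)+
  then have "emeasure (distr lborel borel ranked_vec) (box l u) = emeasure lborel (box (unranked_vec l) (unranked_vec u))"
    by (simp add: emeasure_distr)
  also have "\<dots> = (\<Prod>b\<in>Basis. (unranked_vec u - unranked_vec l) \<bullet> b)"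
    using le by (intro emeasure_lborel_box) (auto simp: Basis_vec_def inner_axis unranked_vec_def)
  also have "\<dots> = (\<Prod>j\<in>UNIV. u $ to_ranked j - l $ to_ranked j)"
    by (simp add: prod_Basis_vec inner_axis unranked_vec_def)
  also have "\<dots> = (\<Prod>b\<in>Basis. (u - l) \<bullet> b)"
    by (simp add: prod.reindex_bij_betw[OF bij_to_ranked, of "\<lambda>i. u $ i - l $ i"] prod_Basis_vec inner_axis)
  finally show "emeasure (distr lborel borel ranked_vec) (box l u) = (\<Prod>b\<in>Basis. (u - l) \<bullet> b)" .
qed simp

lemma det_ranked_mat: "det (ranked_mat M) = det (M :: real^'n::finite^'n)"
  unfolding det_def
proof (rule sum.reindex_bij_witness[where j="map_permutation UNIV of_ranked" and i="map_permutation UNIV to_ranked"])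
  fix q :: "'n ranked \<Rightarrow> 'n ranked" assume "q \<in> {q. q permutes UNIV}"
  then have q: "q permutes UNIV" by simp
  show "map_permutation UNIV to_ranked (map_permutation UNIV of_ranked q) = q"
    using bij_of_ranked q by (rule map_permutation_compose_inv) (simp add: of_ranked_inverse)
  show "map_permutation UNIV of_ranked q \<in> {p. p permutes UNIV}"
    using map_permutation_permutes[OF bij_of_ranked q] by simp
  have "(\<Prod>i\<in>UNIV. M $ i $ map_permutation UNIV of_ranked q i)
      = (\<Prod>i\<in>UNIV. M $ of_ranked i $ map_permutation UNIV of_ranked q (of_ranked i))"
    by (rule prod.reindex_bij_betw[OF bij_of_ranked, symmetric])
  also have "\<dots> = (\<Prod>i\<in>UNIV. ranked_mat M $ i $ q i)"
    by (simp add: map_permutation_apply bij_is_inj[OF bij_of_ranked] ranked_mat_def)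
  finally show "of_int (sign (map_permutation UNIV of_ranked q)) * (\<Prod>i\<in>UNIV. M $ i $ map_permutation UNIV of_ranked q i)
      = of_int (sign q) * (\<Prod>i\<in>UNIV. ranked_mat M $ i $ q i)"
    using q by (simp add: sign_map_permutation bij_is_inj[OF bij_of_ranked])
next
  fix p :: "'n \<Rightarrow> 'n" assume "p \<in> {p. p permutes UNIV}"
  then have p: "p permutes UNIV" by simp
  show "map_permutation UNIV of_ranked (map_permutation UNIV to_ranked p) = p"
    using bij_to_ranked p by (rule map_permutation_compose_inv) (simp add: to_ranked_inverse)
  show "map_permutation UNIV to_ranked p \<in> {q. q permutes UNIV}"
    using map_permutation_permutes[OF bij_to_ranked p] by simp
qed

lemma absolutely_integrable_on_UNIV_iff_lborel:
  fixes F :: "'a::euclidean_space \<Rightarrow> real"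
  assumes "F \<in> borel_measurable borel"
  shows "F absolutely_integrable_on UNIV \<longleftrightarrow> integrable lborel F"
  using assms by (simp add: absolutely_integrable_on_def set_integrable_def integrable_completion)

lemma lborel_integral_matrix_change_wellorder:
  fixes M :: "real^'n::{finite,wellorder}^'n::{finite,wellorder}"
    and F :: "real^'n::{finite,wellorder} \<Rightarrow> real"
  assumes M: "det M \<noteq> 0" and F: "integrable lborel F"
  shows "integrable lborel (\<lambda>t. F (M *v t))
    \<and> (\<integral>t. F (M *v t) \<partial>lborel) = (\<integral>t. F t \<partial>lborel) / \<bar>det M\<bar>"
proof -
  have "F \<in> borel_measurable borel"
    using F by auto
  moreover have "(*v) M \<in> borel_measurable borel"
    by (intro borel_measurable_continuous_onI linear_continuous_on
        linear_conv_bounded_linear[THEN iffD1] matrix_vector_mul_linear)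
  ultimately have [measurable]: "(\<lambda>t. F (M *v t)) \<in> borel_measurable borel"
    by (simp add: measurable_compose)
  obtain A where A: "M ** A = mat 1" "A ** M = mat 1"
    using M by (auto simp: invertible_det_nz[symmetric] invertible_def)
  have "(\<lambda>x. \<bar>det (matrix ((*v) M))\<bar> * F (M *v x)) absolutely_integrable_on UNIV
        \<and> integral UNIV (\<lambda>x. \<bar>det (matrix ((*v) M))\<bar> * F (M *v x)) = integral UNIV F
      \<longleftrightarrow> F absolutely_integrable_on UNIV \<and> integral UNIV F = integral UNIV F"
  proof (rule cov_invertible_real[where h="(*v) A" and h'="\<lambda>_. (*v) A"])
    show "((*v) M has_derivative (*v) M) (at x within UNIV)"
      "((*v) A has_derivative (*v) A) (at x within UNIV)" for x
      by (simp_all add: linear_imp_has_derivative)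
  qed (use A in \<open>simp_all add: matrix_vector_mul_assoc fun_eq_iff\<close>)
  then have "integrable lborel (\<lambda>x. \<bar>det M\<bar> * F (M *v x))"
    "integral UNIV (\<lambda>x. \<bar>det M\<bar> * F (M *v x)) = integral UNIV F"
    using F by (simp_all add: absolutely_integrable_on_UNIV_iff_lborel)
  then show ?thesis
    using M F by (simp add: integral_lborel field_simps)
qed

lemma lborel_integral_ranked_vec:
  fixes F :: "real^'n::finite ranked \<Rightarrow> real"
  assumes "F \<in> borel_measurable borel"
  shows "integrable lborel (\<lambda>t. F (ranked_vec t)) \<longleftrightarrow> integrable lborel F"
    and "(\<integral>t. F (ranked_vec t) \<partial>lborel) = (\<integral>t. F t \<partial>lborel)"
  using integrable_distr_eq[of ranked_vec lborel borel F] integral_distr[of ranked_vec lborel borel F] assms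
  by (simp_all add: distr_ranked_vec_lborel)

lemma lborel_integral_matrix_change:
  fixes M :: "real^'n::finite^'n" and F :: "real^'n \<Rightarrow> real"
  assumes M: "det M \<noteq> 0" and F: "integrable lborel F"
  shows "integrable lborel (\<lambda>t. F (M *v t))"
    and "(\<integral>t. F (M *v t) \<partial>lborel) = (\<integral>t. F t \<partial>lborel) / \<bar>det M\<bar>"
proof -
  define F' where "F' = F \<circ> unranked_vec"
  have F'm [measurable]: "F' \<in> borel_measurable borel"
    using F by (auto simp: F'_def)
  have "integrable lborel F'" "(\<integral>s. F' s \<partial>lborel) = (\<integral>t. F t \<partial>lborel)"
    using lborel_integral_ranked_vec[OF F'm] F by (simp_all add: F'_def)
  then have G: "integrable lborel (\<lambda>s. F' (ranked_mat M *v s))"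
    "(\<integral>s. F' (ranked_mat M *v s) \<partial>lborel) = (\<integral>t. F t \<partial>lborel) / \<bar>det M\<bar>"
    using lborel_integral_matrix_change_wellorder[of "ranked_mat M" F'] M by (simp_all add: det_ranked_mat)
  have "(\<lambda>s. F' (ranked_mat M *v s)) \<in> borel_measurable borel"
    using borel_measurable_integrable[OF G(1)] by simp
  from lborel_integral_ranked_vec[OF this] G
  show "integrable lborel (\<lambda>t. F (M *v t))"
    and "(\<integral>t. F (M *v t) \<partial>lborel) = (\<integral>t. F t \<partial>lborel) / \<bar>det M\<bar>"
    by (simp_all add: ranked_mat_mult_ranked_vec F'_def)
qed

section \<open>The kernel \<open>K\<^sub>\<theta>\<close>\<close>

lemma assumption_G_integrable:
  assumes G: "assumption_G l g"
  shows "integrable lborel g" and "integrable lborel (\<lambda>x. \<bar>g x\<bar>)"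
    and "integrable lborel (\<lambda>x. (g x)\<^sup>2)"
proof -
  have "integrable lborel (\<lambda>x. \<phi> (g x))" if "continuous_on UNIV \<phi>" "\<phi> 0 = 0" for \<phi> :: "real \<Rightarrow> real"
    using G that by (intro integrable_lborel_comp_of_support[where a="-1/2" and b="1/2"])
      (auto simp: assumption_G_def intro: C1_differentiable_imp_continuous_on)
  from this[of "\<lambda>x. x"] this[of abs] this[of "\<lambda>x. x\<^sup>2"]
  show "integrable lborel g" "integrable lborel (\<lambda>x. \<bar>g x\<bar>)" "integrable lborel (\<lambda>x. (g x)\<^sup>2)"
    by (simp_all add: continuous_on_id continuous_on_rabs continuous_on_power)
qed

lemma assumption_G_integral:
  assumes G: "assumption_G l g"
  shows "(\<integral>x. g x \<partial>lborel) = 1"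
proof -
  have "((\<lambda>x. if x \<in> {-1/2..1/2} then g x else 0) has_integral 1) UNIV"
    using G unfolding assumption_G_def by (subst has_integral_restrict_UNIV) blast
  moreover have "(\<lambda>x. if x \<in> {-1/2..1/2} then g x else 0) = g"
    using G by (auto simp: assumption_G_def)
  ultimately show ?thesis
    using has_integral_integral_lborel[OF assumption_G_integrable(1)[OF G]] has_integral_unique by auto
qed

lemma Gh_eq_prod:
  "Gh g A h t = (\<Prod>j\<in>UNIV. if j \<in> A then 1 / h $ j * g (t $ j / h $ j) else g (t $ j))"
  by (simp add: Gh_def prod.If_cases Compl_eq_Diff_UNIV[symmetric])

lemma Gh_integrals:
  fixes h :: "real^'n::finite"
  assumes G: "assumption_G l g" and h: "\<forall>j. h $ j > 0"
  shows "integrable lborel (Gh g A h)"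
    and "(\<integral>t. Gh g A h t \<partial>lborel) = 1"
    and "integrable lborel (\<lambda>t. \<bar>Gh g A h t\<bar>)"
    and "(\<integral>t. \<bar>Gh g A h t\<bar> \<partial>lborel) = (\<integral>x. \<bar>g x\<bar> \<partial>lborel) ^ CARD('n)"
    and "integrable lborel (\<lambda>t. (Gh g A h t)\<^sup>2)"
    and "(\<integral>t. (Gh g A h t)\<^sup>2 \<partial>lborel) = (\<integral>x. (g x)\<^sup>2 \<partial>lborel) ^ CARD('n) * (\<Prod>j\<in>A. 1 / h $ j)"
proof -
  have h0: "h $ j \<noteq> 0" for j using h by (metis less_irrefl)
  have abs_Gh: "\<bar>Gh g A h t\<bar> = (\<Prod>j\<in>UNIV. if j \<in> A then 1 / h $ j * \<bar>g (t $ j / h $ j)\<bar> else \<bar>g (t $ j)\<bar>)" for t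
    using h by (simp add: Gh_eq_prod abs_prod abs_mult if_distrib less_imp_le cong: if_cong)
  have sq_Gh: "(Gh g A h t)\<^sup>2 = (\<Prod>j\<in>UNIV. if j \<in> A then 1 / (h $ j)\<^sup>2 * (g (t $ j / h $ j))\<^sup>2 else (g (t $ j))\<^sup>2)" for t
    unfolding Gh_eq_prod prod_power_distrib by (intro prod.cong) (auto simp: power_divide)
  note rescaled = lborel_integral_prod_rescaled[OF _ h, where A=A]
  note g = assumption_G_integrable[OF G]
  show "integrable lborel (Gh g A h)" "(\<integral>t. Gh g A h t \<partial>lborel) = 1"
    using rescaled[OF g(1), of "\<lambda>j. 1 / h $ j"] assumption_G_integral[OF G] h0 by (simp_all add: Gh_eq_prod[abs_def])
  show "integrable lborel (\<lambda>t. \<bar>Gh g A h t\<bar>)"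
    "(\<integral>t. \<bar>Gh g A h t\<bar> \<partial>lborel) = (\<integral>x. \<bar>g x\<bar> \<partial>lborel) ^ CARD('n)"
    using rescaled[OF g(2), of "\<lambda>j. 1 / h $ j"] h0 by (simp_all add: abs_Gh)
  have "(\<Prod>j\<in>A. 1 / (h $ j)\<^sup>2 * h $ j) = (\<Prod>j\<in>A. 1 / h $ j)"
    using h0 by (intro prod.cong) (simp_all add: power2_eq_square)
  with rescaled[OF g(3), of "\<lambda>j. 1 / (h $ j)\<^sup>2"]
  show "integrable lborel (\<lambda>t. (Gh g A h t)\<^sup>2)"
    "(\<integral>t. (Gh g A h t)\<^sup>2 \<partial>lborel) = (\<integral>x. (g x)\<^sup>2 \<partial>lborel) ^ CARD('n) * (\<Prod>j\<in>A. 1 / h $ j)"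
    by (simp_all add: sq_Gh mult.commute)
qed

lemma Gh_matrix_integrals:
  fixes M :: "real^'n::finite^'n" and h :: "real^'n"
  assumes G: "assumption_G l g" and h: "\<forall>j. h $ j > 0" and M: "det M \<noteq> 0"
  shows "integrable lborel (\<lambda>t. Gh g A h (M *v t))"
    and "(\<integral>t. Gh g A h (M *v t) \<partial>lborel) = 1 / \<bar>det M\<bar>"
    and "integrable lborel (\<lambda>t. \<bar>Gh g A h (M *v t)\<bar>)"
    and "(\<integral>t. \<bar>Gh g A h (M *v t)\<bar> \<partial>lborel) = (\<integral>x. \<bar>g x\<bar> \<partial>lborel) ^ CARD('n) / \<bar>det M\<bar>"
    and "integrable lborel (\<lambda>t. (Gh g A h (M *v t))\<^sup>2)"
    and "L2_norm lborel (\<lambda>t. Gh g A h (M *v t))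
      = L2_norm lborel g ^ CARD('n) * (\<Prod>j\<in>A. h $ j powr (-1/2)) / sqrt \<bar>det M\<bar>"
proof -
  note change = lborel_integral_matrix_change[OF M]
  note Gh = Gh_integrals[OF G h, of A]
  show "integrable lborel (\<lambda>t. Gh g A h (M *v t))"
    "(\<integral>t. Gh g A h (M *v t) \<partial>lborel) = 1 / \<bar>det M\<bar>"
    using change[OF Gh(1)] Gh(2) by simp_all
  show "integrable lborel (\<lambda>t. \<bar>Gh g A h (M *v t)\<bar>)"
    "(\<integral>t. \<bar>Gh g A h (M *v t)\<bar> \<partial>lborel) = (\<integral>x. \<bar>g x\<bar> \<partial>lborel) ^ CARD('n) / \<bar>det M\<bar>"
    using change[OF Gh(3)] Gh(4) by simp_all
  show "integrable lborel (\<lambda>t. (Gh g A h (M *v t))\<^sup>2)"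
    using change[OF Gh(5)] by simp
  have "sqrt (\<Prod>j\<in>A. 1 / h $ j) = (\<Prod>j\<in>A. 1 / h $ j) powr (1/2)"
    using h by (simp add: powr_half_sqrt prod_nonneg less_imp_le)
  also have "\<dots> = (\<Prod>j\<in>A. h $ j powr (-1/2))"
    using h by (simp add: prod_powr_distrib powr_divide powr_minus_divide less_imp_le)
  finally have "sqrt (\<Prod>j\<in>A. 1 / h $ j) = (\<Prod>j\<in>A. h $ j powr (-1/2))" .
  then show "L2_norm lborel (\<lambda>t. Gh g A h (M *v t))
      = L2_norm lborel g ^ CARD('n) * (\<Prod>j\<in>A. h $ j powr (-1/2)) / sqrt \<bar>det M\<bar>"
    using change(2)[OF Gh(5)] Gh(6)
    by (simp add: L2_norm_def real_sqrt_mult real_sqrt_divide real_sqrt_power)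
qed

lemma Ktheta_eq_Gh:
  "Ktheta g P E h t = \<bar>det E\<bar> * (\<Sum>A\<in>P. Gh g A h (transpose E *v t))
     - (real (card P) - 1) * \<bar>det E\<bar> * Gh g {} h (transpose E *v t)"
  by (simp add: Ktheta_def G0_def Gh_def)

lemma integral_Ktheta:
  fixes E :: "real^'n::finite^'n" and h :: "real^'n"
  assumes G: "assumption_G l g" and h: "\<forall>j. h $ j > 0" and E: "det E \<noteq> 0"
  shows "integrable lborel (Ktheta g P E h)" and "(\<integral>t. Ktheta g P E h t \<partial>lborel) = 1"
proof -
  have "det (transpose E) \<noteq> 0"
    using E by simp
  note Gh = Gh_matrix_integrals[OF G h this, unfolded det_transpose]
  show "integrable lborel (Ktheta g P E h)"
    using Gh(1) E by (simp add: Ktheta_eq_Gh[abs_def])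
  have "(\<integral>t. Ktheta g P E h t \<partial>lborel)
      = \<bar>det E\<bar> * (real (card P) * (1 / \<bar>det E\<bar>)) - (real (card P) - 1) * \<bar>det E\<bar> * (1 / \<bar>det E\<bar>)"
    using Gh(1,2) E by (simp add: Ktheta_eq_Gh integral_sum)
  also have "\<dots> = 1"
    using E by (simp add: field_simps)
  finally show "(\<integral>t. Ktheta g P E h t \<partial>lborel) = 1" .
qed

lemma integral_abs_Ktheta_le:
  fixes E :: "real^'n::finite^'n" and h :: "real^'n"
  assumes G: "assumption_G l g" and h: "\<forall>j. h $ j > 0" and E: "det E \<noteq> 0" and P: "P \<noteq> {}"
  shows "(\<integral>t. \<bar>Ktheta g P E h t\<bar> \<partial>lborel)
    \<le> (2 * real (card P) - 1) * (\<integral>x. \<bar>g x\<bar> \<partial>lborel) ^ CARD('n)"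
proof -
  define \<Phi> where "\<Phi> A t = Gh g A h (transpose E *v t)" for A t
  define c where "c = real (card P)"
  define d where "d = \<bar>det E\<bar>"
  have "det (transpose E) \<noteq> 0"
    using E by simp
  note Gh = Gh_matrix_integrals[OF G h this, unfolded det_transpose, folded \<Phi>_def d_def]
  have c: "c \<ge> 1"
    using P by (simp add: c_def Suc_le_eq card_gt_0_iff)
  have d: "d > 0"
    using E by (simp add: d_def)
  have bound: "\<bar>Ktheta g P E h t\<bar> \<le> d * (\<Sum>A\<in>P. \<bar>\<Phi> A t\<bar>) + (c - 1) * d * \<bar>\<Phi> {} t\<bar>" for t
  proof -
    have "\<bar>Ktheta g P E h t\<bar> \<le> \<bar>d * (\<Sum>A\<in>P. \<Phi> A t)\<bar> + \<bar>(c - 1) * d * \<Phi> {} t\<bar>"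
      unfolding Ktheta_eq_Gh \<Phi>_def c_def d_def by (rule abs_triangle_ineq4)
    also have "\<dots> \<le> d * (\<Sum>A\<in>P. \<bar>\<Phi> A t\<bar>) + (c - 1) * d * \<bar>\<Phi> {} t\<bar>"
      using c d by (simp add: abs_mult sum_abs mult_left_mono)
    finally show ?thesis .
  qed
  have "(\<integral>t. \<bar>Ktheta g P E h t\<bar> \<partial>lborel)
      \<le> (\<integral>t. d * (\<Sum>A\<in>P. \<bar>\<Phi> A t\<bar>) + (c - 1) * d * \<bar>\<Phi> {} t\<bar> \<partial>lborel)"
    using integral_Ktheta(1)[OF G h E] Gh(3) bound by (intro integral_mono) auto
  also have "\<dots> = d * (c * ((\<integral>x. \<bar>g x\<bar> \<partial>lborel) ^ CARD('n) / d))
      + (c - 1) * d * ((\<integral>x. \<bar>g x\<bar> \<partial>lborel) ^ CARD('n) / d)"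
    using Gh(3,4) by (simp add: integral_sum c_def)
  also have "\<dots> = (2 * c - 1) * (\<integral>x. \<bar>g x\<bar> \<partial>lborel) ^ CARD('n)"
    using d by (simp add: field_simps)
  finally show ?thesis by (simp add: c_def)
qed

lemma L2_norm_Ktheta_le:
  fixes E :: "real^'n::finite^'n" and h :: "real^'n"
  assumes G: "assumption_G l g" and h: "\<forall>j. h $ j > 0" and E: "det E \<noteq> 0" and P: "P \<noteq> {}"
  shows "integrable lborel (\<lambda>t. (Ktheta g P E h t)\<^sup>2)"
    and "L2_norm lborel (Ktheta g P E h) \<le> sqrt \<bar>det E\<bar> * L2_norm lborel g ^ CARD('n)
      * ((\<Sum>A\<in>P. \<Prod>j\<in>A. h $ j powr (-1/2)) + real (card P) - 1)"
proof -
  define \<Phi> where "\<Phi> A t = Gh g A h (transpose E *v t)" for A t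
  define \<pi> where "\<pi> A = (\<Prod>j\<in>A. h $ j powr (-1/2))" for A :: "'n set"
  define c where "c = real (card P)"
  define d where "d = \<bar>det E\<bar>"
  have "det (transpose E) \<noteq> 0"
    using E by simp
  note Gh = Gh_matrix_integrals[OF G h this, unfolded det_transpose, folded \<Phi>_def d_def \<pi>_def]
  have c: "c \<ge> 1"
    using P by (simp add: c_def Suc_le_eq card_gt_0_iff)
  have d: "d > 0"
    using E by (simp add: d_def)
  have meas: "(\<lambda>t. a * \<Phi> A t) \<in> borel_measurable lborel" for a A
    using borel_measurable_integrable[OF Gh(1)[of A]] by simp
  have sq: "integrable lborel (\<lambda>t. (a * \<Phi> A t)\<^sup>2)" for a A
    using Gh(5)[of A] by (simp add: power_mult_distrib)
  define k where "k = d / sqrt d * L2_norm lborel g ^ CARD('n)"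
  have norm: "L2_norm lborel (\<lambda>t. a * \<Phi> A t) = \<bar>a\<bar> / d * k * \<pi> A" for a A
    using Gh(6)[of A] d by (simp add: L2_norm_cmult k_def)
  have K: "Ktheta g P E h = (\<lambda>t. (\<Sum>A\<in>P. d * \<Phi> A t) + ((1 - c) * d) * \<Phi> {} t)"
    by (simp add: fun_eq_iff Ktheta_eq_Gh \<Phi>_def c_def d_def sum_distrib_left algebra_simps)
  note sum = L2_norm_sum_le[of P "\<lambda>A t. d * \<Phi> A t" lborel, OF _ meas sq, simplified]
  have "(\<lambda>t. \<Sum>A\<in>P. d * \<Phi> A t) \<in> borel_measurable lborel"
    by (rule borel_measurable_sum) (rule meas)
  note Minkowski = L2_norm_add_le[OF this meas conjunct1[OF sum] sq]
  show "integrable lborel (\<lambda>t. (Ktheta g P E h t)\<^sup>2)"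
    using Minkowski(1) K by simp
  have "L2_norm lborel (Ktheta g P E h)
      \<le> L2_norm lborel (\<lambda>t. \<Sum>A\<in>P. d * \<Phi> A t) + L2_norm lborel (\<lambda>t. ((1 - c) * d) * \<Phi> {} t)"
    unfolding K by (rule Minkowski(2))
  also have "\<dots> \<le> (\<Sum>A\<in>P. L2_norm lborel (\<lambda>t. d * \<Phi> A t)) + L2_norm lborel (\<lambda>t. ((1 - c) * d) * \<Phi> {} t)"
    using conjunct2[OF sum] by simp
  also have "\<dots> = (\<Sum>A\<in>P. k * \<pi> A) + (c - 1) * k"
    using c d by (simp add: norm \<pi>_def abs_mult)
  also have "\<dots> = k * ((\<Sum>A\<in>P. \<pi> A) + c - 1)"
    by (simp add: sum_distrib_left algebra_simps)
  also have "k = sqrt \<bar>det E\<bar> * L2_norm lborel g ^ CARD('n)"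
    using d by (simp add: k_def d_def real_div_sqrt)
  finally show "L2_norm lborel (Ktheta g P E h) \<le> sqrt \<bar>det E\<bar> * L2_norm lborel g ^ CARD('n)
      * ((\<Sum>A\<in>P. \<Prod>j\<in>A. h $ j powr (-1/2)) + real (card P) - 1)"
    by (simp add: \<pi>_def c_def)
qed

theorem lemma3:
  fixes g :: "real \<Rightarrow> real" and l :: nat and \<eta> :: real
    and P :: "'n::finite set set" and E :: "real^'n^'n" and h :: "real^'n"
  assumes G: "assumption_G l g"
    and eta: "\<eta> > 0"
    and part: "partition_on UNIV P"
    and E: "E \<in> E_eta \<eta>"
    and h: "\<forall>j. h $ j > 0"
  shows "(Ktheta g P E h has_integral 1) UNIV
    \<and> Ktheta g P E h absolutely_integrable_on UNIV
    \<and> integral UNIV (\<lambda>t. \<bar>Ktheta g P E h t\<bar>)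
           \<le> (2 * real (card P) - 1) * (integral UNIV (\<lambda>x. \<bar>g x\<bar>)) ^ CARD('n)
    \<and> (\<lambda>t. (Ktheta g P E h t)\<^sup>2) integrable_on UNIV
    \<and> sqrt (integral UNIV (\<lambda>t. (Ktheta g P E h t)\<^sup>2))
           \<le> \<bar>det E\<bar> powr (1/2) * (sqrt (integral UNIV (\<lambda>x. (g x)\<^sup>2))) ^ CARD('n)
             * ((\<Sum>A\<in>P. \<Prod>j\<in>A. h $ j powr (-1/2)) + real (card P) - 1)"
proof -
  have det: "det E \<noteq> 0"
    using E eta by (auto simp: E_eta_def)
  have P: "P \<noteq> {}"
    using part by (auto simp: partition_on_def)
  note K = integral_Ktheta[OF G h det]
  note L2 = L2_norm_Ktheta_le[OF G h det P]
  have "Ktheta g P E h \<in> borel_measurable borel"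
    using K(1) by auto
  moreover have "(Ktheta g P E h has_integral 1) UNIV"
    using has_integral_integral_lborel[OF K(1)] K(2) by simp
  ultimately show ?thesis
    using K(1) L2 integral_abs_Ktheta_le[OF G h det P] assumption_G_integrable[OF G]
    by (simp add: absolutely_integrable_on_UNIV_iff_lborel
        integrable_on_lborel integral_lborel L2_norm_def powr_half_sqrt)
qed

end
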